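(* For every $\theta\in\mathbb{F}_q((1/t))$, the set $BA_\theta=\{\gamma\in\mathbb{F}_q((1/t)):c(\theta,\gamma)>0\}$ has Hausdorff dimension $1$.
   Context: $q$ is a prime power, $\mathbb{F}_q[t]$ the polynomial ring over $\mathbb{F}_q$, and $\mathbb{F}_q((1/t))$ the field of Laurent series $\theta=\sum_i\theta_it^{-i}$ with finitely many nonzero coefficients of positive powers of $t$. Absolute value: $|\theta|=q^{\deg\theta}$ with $\deg\theta=\max\{-i:\theta_i\neq0\}$, $|0|=0$ (so $|N|=q^{\deg N}$ for polynomials $N\ne0$). Fractional part: $\langle\theta\rangle=\sum_{i\ge1}\theta_it^{-i}$. $c(\theta,\gamma)=\inf_{0\ne N\in\mathbb{F}_q[t]}|N|\cdot|\langle N\theta-\gamma\rangle|$. Hausdorff dimension is with respect to the metric $|\theta-\varphi|$. *)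

theory Defs
  imports
    "HOL-Computational_Algebra.Formal_Laurent_Series"
    "HOL-Library.Extended_Nonnegative_Real"
    "HOL-Library.Cardinality"
begin

section \<open>Hausdorff dimension\<close>

text \<open>
  The distance function \<open>d\<close> is an explicit argument because the \<open>dist\<close> of the metric-space instance
  of \<^typ>\<open>'a fls\<close> is normalised to base 2, and the dimension depends on this normalisation.
\<close>

definition diam_wrt :: "('a \<Rightarrow> 'a \<Rightarrow> real) \<Rightarrow> 'a set \<Rightarrow> ennreal" where
  "diam_wrt d U = (SUP (x, y) \<in> U \<times> U. ennreal (d x y))"

definition hausdorff_premeasure ::
    "('a \<Rightarrow> 'a \<Rightarrow> real) \<Rightarrow> real \<Rightarrow> real \<Rightarrow> 'a set \<Rightarrow> ennreal" where
  "hausdorff_premeasure d s \<delta> A =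
     (INF U \<in> {U :: nat \<Rightarrow> 'a set. A \<subseteq> (\<Union>i. U i) \<and> (\<forall>i. diam_wrt d (U i) \<le> ennreal \<delta>)}.
        (\<Sum>i. ennreal (enn2real (diam_wrt d (U i)) powr s)))"

text \<open>
  The outer measure below is meant for exponents \<open>s > 0\<close> only: since \<open>0 powr 0 = 0\<close>, it is not the
  counting measure for \<open>s = 0\<close>. Leaving out \<open>s = 0\<close> does not change the infimum in \<open>hausdorff_dim\<close>.
\<close>

definition hausdorff_measure :: "('a \<Rightarrow> 'a \<Rightarrow> real) \<Rightarrow> real \<Rightarrow> 'a set \<Rightarrow> ennreal" where
  "hausdorff_measure d s A = (SUP \<delta> \<in> {0<..}. hausdorff_premeasure d s \<delta> A)"

definition hausdorff_dim :: "('a \<Rightarrow> 'a \<Rightarrow> real) \<Rightarrow> 'a set \<Rightarrow> ennreal" where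
  "hausdorff_dim d A = Inf {ennreal s | s. 0 < s \<and> hausdorff_measure d s A = 0}"


section \<open>Laurent series in \<open>1/t\<close> over a finite field\<close>

text \<open>
  The field \<open>F\<^sub>q((1/t))\<close> is \<^typ>\<open>'a fls\<close> with \<open>'a\<close> a finite field, \<open>q = CARD('a)\<close>, where the formal
  variable \<^const>\<open>fls_X\<close> stands for \<open>1/t\<close>. So \<open>fls_nth \<theta> i\<close> is the coefficient of \<open>t\<close> to the power \<open>-i\<close>,
  \<^const>\<open>fls_X_inv\<close> is \<open>t\<close>, and the degree in \<open>t\<close> of a nonzero series is minus its
  \<^const>\<open>fls_subdegree\<close>.
\<close>

definition laurent_abs :: "'a::{field,finite} fls \<Rightarrow> real" where
  "laurent_abs \<theta> = (if \<theta> = 0 then 0 else real CARD('a) powi (- fls_subdegree \<theta>))"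

definition laurent_dist :: "'a::{field,finite} fls \<Rightarrow> 'a fls \<Rightarrow> real" where
  "laurent_dist \<theta> \<phi> = laurent_abs (\<theta> - \<phi>)"

definition laurent_of_poly :: "'a::field poly \<Rightarrow> 'a fls" where
  "laurent_of_poly N = poly (map_poly fls_const N) fls_X_inv"

definition laurent_frac :: "'a::field fls \<Rightarrow> 'a fls" where
  "laurent_frac \<theta> = fps_to_fls (Abs_fps (\<lambda>n. if n = 0 then 0 else fls_nth \<theta> (int n)))"

lemma laurent_frac_nth: "fls_nth (laurent_frac \<theta>) i = (if i \<ge> 1 then fls_nth \<theta> i else 0)"
  by (simp add: laurent_frac_def)

lemma laurent_of_poly_nth:
  "fls_nth (laurent_of_poly N) i = (if i \<le> 0 then coeff N (nat (- i)) else 0)"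
proof (induction N arbitrary: i)
  case 0
  then show ?case by (simp add: laurent_of_poly_def)
next
  case (pCons a N)
  have "laurent_of_poly (pCons a N) = fls_const a + fls_X_inv * laurent_of_poly N"
    using pCons.hyps by (simp add: laurent_of_poly_def map_poly_pCons)
  then have "fls_nth (laurent_of_poly (pCons a N)) i =
      (if i = 0 then a else 0) + fls_nth (laurent_of_poly N) (i + 1)"
    by (simp add: fls_X_inv_times_conv_shift)
  moreover have "nat (- i) = Suc (nat (- (i + 1)))" if "i < 0"
    using that by simp
  ultimately show ?case
    using pCons.IH[of "i + 1"] by (cases "i = 0"; cases "i < 0") simp_all
qed

lemma laurent_abs_of_poly:
  fixes N :: "'a::{field,finite} poly"
  assumes "N \<noteq> 0"
  shows "laurent_abs (laurent_of_poly N) = real CARD('a) ^ degree N"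
proof -
  have nz: "fls_nth (laurent_of_poly N) (- int (degree N)) \<noteq> 0"
    using assms by (simp add: laurent_of_poly_nth)
  have "fls_subdegree (laurent_of_poly N) = - int (degree N)"
    by (rule fls_subdegree_eqI[OF nz]) (auto simp: laurent_of_poly_nth intro: coeff_eq_0)
  moreover have "laurent_of_poly N \<noteq> 0"
    using nz by auto
  ultimately show ?thesis
    by (simp add: laurent_abs_def)
qed


section \<open>Inhomogeneous badly approximable elements\<close>

definition approx_const :: "'a::{field,finite} fls \<Rightarrow> 'a fls \<Rightarrow> real" where
  "approx_const \<theta> \<gamma> =
     (INF N \<in> {N :: 'a poly. N \<noteq> 0}.
        laurent_abs (laurent_of_poly N) * laurent_abs (laurent_frac (laurent_of_poly N * \<theta> - \<gamma>)))"

definition BA :: "'a::{field,finite} fls \<Rightarrow> 'a fls set" where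
  "BA \<theta> = {\<gamma>. approx_const \<theta> \<gamma> > 0}"

end

theory Submission
  imports Defs "HOL-Analysis.Caratheodory"
begin

text \<open>
  For each degree \<open>d\<close> let \<open>Q d\<close> be a polynomial of degree \<open>d\<close> minimising \<open>|\<langle>Q d \<theta>\<rangle>|\<close>. If \<open>|\<langle>Q d \<gamma>\<rangle>|\<close>
  is bounded away from 0 uniformly in \<open>d\<close>, then \<open>\<gamma>\<close> lies in \<open>BA \<theta>\<close>. Group the digits of \<open>\<gamma>\<close> into
  blocks of length \<open>c\<close>: once the previous blocks are fixed, the condition for \<open>d\<close> can be met by avoiding a
  single value of the block after the one containing \<open>d\<close>. So at least \<open>q\<^sup>c - c\<close> of the \<open>q\<^sup>c\<close> values of
  each block are allowed, and the resulting Cantor set has dimension at least \<open>s\<close> as soon as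
  \<open>q\<^sup>c - c\<close> is at least the \<open>s\<close>-th power of \<open>q\<^sup>c\<close>.
\<close>

section \<open>Hausdorff measure and trees\<close>

lemma hausdorff_premeasure_mono:
  assumes "A \<subseteq> B"
  shows "hausdorff_premeasure d s \<delta> A \<le> hausdorff_premeasure d s \<delta> B"
  unfolding hausdorff_premeasure_def using assms by (intro INF_superset_mono) auto

lemma hausdorff_premeasure_le:
  assumes "A \<subseteq> (\<Union>i. U i)" and "\<And>i. diam_wrt d (U i) \<le> ennreal \<delta>"
  shows "hausdorff_premeasure d s \<delta> A \<le> (\<Sum>i. ennreal (enn2real (diam_wrt d (U (i::nat))) powr s))"
  unfolding hausdorff_premeasure_def using assms by (intro INF_lower) auto

lemma hausdorff_premeasure_lessE:
  assumes "hausdorff_premeasure d s \<delta> A < e"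
  obtains U :: "nat \<Rightarrow> 'a set" where "A \<subseteq> (\<Union>i. U i)" "\<And>i. diam_wrt d (U i) \<le> ennreal \<delta>"
    "(\<Sum>i. ennreal (enn2real (diam_wrt d (U i)) powr s)) < e"
  using assms unfolding hausdorff_premeasure_def INF_less_iff by auto

text \<open>Countable subadditivity for null sets: covers of cost below
  \<open>e * (1/2) ^ Suc k\<close> are merged along \<open>prod_decode\<close>. It serves to pass
  from bounded pieces of the field to the whole field.\<close>

lemma hausdorff_premeasure_UN_eq_0:
  fixes A :: "nat \<Rightarrow> 'a set"
  assumes "\<And>k. hausdorff_premeasure d s \<delta> (A k) = 0"
  shows "hausdorff_premeasure d s \<delta> (\<Union>k. A k) = 0"
proof -
  let ?w = "\<lambda>U. ennreal (enn2real (diam_wrt d U) powr s)"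
  have "hausdorff_premeasure d s \<delta> (\<Union>k. A k) \<le> 0 + ennreal e" if e: "e > 0" for e
  proof -
    let ?e = "\<lambda>k. ennreal (e * (1/2) ^ Suc k)"
    have "\<exists>U. A k \<subseteq> (\<Union>i. U i) \<and> (\<forall>i. diam_wrt d (U i) \<le> ennreal \<delta>) \<and> (\<Sum>i. ?w (U i)) < ?e k"
      for k
    proof -
      have "?e k > 0"
        using e by simp
      then have "hausdorff_premeasure d s \<delta> (A k) < ?e k"
        by (simp only: assms)
      then show ?thesis
        by (elim hausdorff_premeasure_lessE) blast
    qed
    then obtain U where U: "\<And>k. A k \<subseteq> (\<Union>i. U k i)" "\<And>k i. diam_wrt d (U k i) \<le> ennreal \<delta>"
      "\<And>k. (\<Sum>i. ?w (U k i)) < ?e k"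
      by metis
    define V where "V = (\<lambda>n. case_prod U (prod_decode n))"
    have "(\<Union>k. A k) \<subseteq> (\<Union>n. V n)"
    proof
      fix x assume "x \<in> (\<Union>k. A k)"
      then obtain k i where "x \<in> U k i" using U(1) by blast
      then have "x \<in> V (prod_encode (k, i))" by (simp add: V_def)
      then show "x \<in> (\<Union>n. V n)" by blast
    qed
    moreover have "diam_wrt d (V n) \<le> ennreal \<delta>" for n
      using U(2) by (simp add: V_def split: prod.split)
    ultimately have "hausdorff_premeasure d s \<delta> (\<Union>k. A k) \<le> (\<Sum>n. ?w (V n))"
      by (rule hausdorff_premeasure_le)
    also have "\<dots> = (\<Sum>n. (\<lambda>(k, i). ?w (U k i)) (prod_decode n))"
      by (simp only: V_def case_prod_unfold)
    also have "\<dots> = (\<Sum>k. \<Sum>i. ?w (U k i))"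
      by (rule suminf_ennreal_2dimen) (simp only: prod.case)
    also have "\<dots> \<le> (\<Sum>k. ?e k)"
      using U(3) by (intro suminf_le less_imp_le summableI)
    also have "\<dots> = ennreal (e * 1)"
      using e by (intro suminf_ennreal_eq sums_mult power_half_series) simp
    also have "\<dots> = 0 + ennreal e"
      by simp
    finally show ?thesis .
  qed
  then have "hausdorff_premeasure d s \<delta> (\<Union>k. A k) \<le> 0"
    by (rule ennreal_le_epsilon)
  then show ?thesis by simp
qed

text \<open>The cover is padded to a sequence with empty sets, which have diameter 0 and cost
  \<open>0 powr s = 0\<close>.\<close>

lemma hausdorff_premeasure_le_finite:
  assumes "finite I" and "A \<subseteq> (\<Union>i\<in>I. U i)" and "0 \<le> r" and "r \<le> \<delta>" and "s > 0"
    and "\<And>i. i \<in> I \<Longrightarrow> diam_wrt d (U i) \<le> ennreal r"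
  shows "hausdorff_premeasure d s \<delta> A \<le> ennreal (real (card I) * r powr s)"
proof -
  from ex_bij_betw_nat_finite[OF assms(1)] obtain h where h: "bij_betw h {0..<card I} I" by blast
  define V where "V = (\<lambda>n. if n < card I then U (h n) else {})"
  have V_le: "diam_wrt d (V n) \<le> ennreal r" for n
    using assms(6) h by (auto simp: V_def diam_wrt_def bot_ennreal dest: bij_betwE)
  have "A \<subseteq> (\<Union>n. V n)"
  proof
    fix x assume "x \<in> A"
    then obtain i where i: "i \<in> I" "x \<in> U i" using assms(2) by blast
    then obtain n where "n < card I" "h n = i"
      using bij_betw_imp_surj_on[OF h] by (metis imageE atLeastLessThan_iff)
    with i have "x \<in> V n" by (simp add: V_def)
    then show "x \<in> (\<Union>n. V n)" by blast
  qed
  moreover have "diam_wrt d (V n) \<le> ennreal \<delta>" for n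
    using V_le[of n] assms(4) by (meson ennreal_leI order_trans)
  ultimately have "hausdorff_premeasure d s \<delta> A
      \<le> (\<Sum>n. ennreal (enn2real (diam_wrt d (V n)) powr s))"
    by (rule hausdorff_premeasure_le)
  also have "\<dots> = (\<Sum>n<card I. ennreal (enn2real (diam_wrt d (V n)) powr s))"
    using assms(5) by (intro suminf_finite) (auto simp: V_def diam_wrt_def bot_ennreal)
  also have "\<dots> \<le> (\<Sum>n<card I. ennreal (r powr s))"
    using V_le assms(3,5)
    by (intro sum_mono ennreal_leI powr_mono2) (auto intro: enn2real_leI)
  also have "\<dots> = ennreal (real (card I) * r powr s)"
    by (simp add: ennreal_mult ennreal_of_nat_eq_real_of_nat)
  finally show ?thesis .
qed

text \<open>Nothing is asked at the critical exponent 1, since the infimum is 1 whether or not it is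
  attained.\<close>

lemma hausdorff_dim_eq_1I:
  assumes "\<And>s. s > 1 \<Longrightarrow> hausdorff_measure d s A = 0"
    and "\<And>s. 0 < s \<Longrightarrow> s < 1 \<Longrightarrow> hausdorff_measure d s A \<noteq> 0"
  shows "hausdorff_dim d A = 1"
proof (rule antisym)
  have "hausdorff_dim d A \<le> 1 + ennreal e" if "e > 0" for e
  proof -
    have "hausdorff_dim d A \<le> ennreal (1 + e)"
      unfolding hausdorff_dim_def using assms(1)[of "1 + e"] that
      by (intro Inf_lower CollectI exI[of _ "1 + e"]) simp
    then show ?thesis using that by simp
  qed
  then show "hausdorff_dim d A \<le> 1"
    by (rule ennreal_le_epsilon)
  show "1 \<le> hausdorff_dim d A"
    unfolding hausdorff_dim_def
  proof (rule Inf_greatest)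
    fix x assume "x \<in> {ennreal s |s. 0 < s \<and> hausdorff_measure d s A = 0}"
    then obtain s where "x = ennreal s" "0 < s" "hausdorff_measure d s A = 0" by blast
    then show "1 \<le> x" using assms(2)[of s] by force
  qed
qed

text \<open>
  If the cylinders have total weight below 1, then so do, after rescaling, those inside some child
  of the root; descending in this way gives a branch that never enters a cylinder.
\<close>

lemma branch_avoiding_cylinders:
  fixes A :: "'b list \<Rightarrow> 'b set" and l :: "nat \<Rightarrow> 'b list"
  assumes M: "M > 0" and A: "\<And>v. finite (A v)" "\<And>v. M \<le> card (A v)"
    and less1: "(\<Sum>i. ennreal ((1 / real M) ^ length (l i))) < 1"
  obtains f where "\<And>n. f n \<in> A (map f [0..<n])" "\<And>i. map f [0..<length (l i)] \<noteq> l i"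
proof -
  define w where "w = (\<lambda>v i. if take (length v) (l i) = v then ennreal ((1 / real M) ^ length (l i)) else 0)"
  define W where "W = (\<lambda>v. \<Sum>i. w v i)"
  have step: "\<exists>b\<in>A v. W (v @ [b]) < ennreal ((1 / real M) ^ Suc (length v))"
    if v: "W v < ennreal ((1 / real M) ^ length v)" for v
  proof (rule ccontr)
    assume "\<not> ?thesis"
    then have ge: "\<And>b. b \<in> A v \<Longrightarrow> ennreal ((1 / real M) ^ Suc (length v)) \<le> W (v @ [b])"
      by (auto simp: not_less)
    \<comment> \<open>The word \<open>l i\<close> passes through at most one child of
      \<open>v\<close>, so its weight is not counted twice.\<close>
    have le: "(\<Sum>b\<in>A v. w (v @ [b]) i) \<le> w v i" for i
    proof (cases "\<exists>b\<in>A v. take (length (v @ [b])) (l i) = v @ [b]")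
      case False
      then show ?thesis by (simp add: w_def)
    next
      case True
      then obtain b where b: "b \<in> A v" "take (Suc (length v)) (l i) = v @ [b]" by auto
      have "(\<Sum>b\<in>A v. w (v @ [b]) i) = (\<Sum>x\<in>{b}. w (v @ [x]) i)"
        using b A by (intro sum.mono_neutral_right) (auto simp: w_def)
      moreover have "take (length v) (l i) = v"
        using arg_cong[OF b(2), of "take (length v)"] by (simp add: min_def)
      ultimately show ?thesis by (simp only: w_def) (simp add: b)
    qed
    \<comment> \<open>If every child were too heavy, the children, at least \<open>M\<close> in
      number, would together reach the bound for \<open>v\<close>.\<close>
    have "ennreal ((1 / real M) ^ length v) = of_nat M * ennreal ((1 / real M) ^ Suc (length v))"
      using M by (simp add: ennreal_of_nat_eq_real_of_nat flip: ennreal_mult)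
    also have "\<dots> \<le> of_nat (card (A v)) * ennreal ((1 / real M) ^ Suc (length v))"
      using A(2)[of v] by (intro mult_right_mono) auto
    also have "\<dots> = (\<Sum>b\<in>A v. ennreal ((1 / real M) ^ Suc (length v)))"
      by simp
    also have "\<dots> \<le> (\<Sum>b\<in>A v. W (v @ [b]))"
      using ge by (intro sum_mono)
    also have "\<dots> = (\<Sum>i. \<Sum>b\<in>A v. w (v @ [b]) i)"
      unfolding W_def by (intro suminf_sum[symmetric]) auto
    also have "\<dots> \<le> W v"
      unfolding W_def using le by (intro suminf_le) auto
    finally show False using v by simp
  qed
  \<comment> \<open>The choice runs over prefixes rather than single entries because the admissible
    entries depend on the whole prefix.\<close>
  have "\<exists>g. \<forall>n. (length (g n) = n \<and> W (g n) < ennreal ((1 / real M) ^ n))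
      \<and> (\<exists>b\<in>A (g n). g (Suc n) = g n @ [b])"
  proof (rule dependent_nat_choice)
    show "\<exists>v. length v = 0 \<and> W v < ennreal ((1 / real M) ^ 0)"
      using less1 by (simp add: W_def w_def)
    fix v :: "'b list" and n assume "length v = n \<and> W v < ennreal ((1 / real M) ^ n)"
    moreover from this obtain b where "b \<in> A v" "W (v @ [b]) < ennreal ((1 / real M) ^ Suc n)"
      using step[of v] by auto
    ultimately show "\<exists>y. (length y = Suc n \<and> W y < ennreal ((1 / real M) ^ Suc n)) \<and> (\<exists>b\<in>A v. y = v @ [b])"
      by (intro exI[of _ "v @ [b]"]) auto
  qed
  then obtain g where g: "\<And>n. length (g n) = n" "\<And>n. W (g n) < ennreal ((1 / real M) ^ n)"
    "\<And>n. \<exists>b\<in>A (g n). g (Suc n) = g n @ [b]"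
    by metis
  define f where "f = (\<lambda>n. last (g (Suc n)))"
  have g_Suc: "g (Suc n) = g n @ [f n]" and f: "f n \<in> A (g n)" for n
    using g(3)[of n] by (auto simp: f_def)
  have map_f: "map f [0..<n] = g n" for n
  proof (induction n)
    case 0
    then show ?case using g(1)[of 0] by simp
  qed (simp add: g_Suc)
  show thesis
  proof
    show "f n \<in> A (map f [0..<n])" for n
      using f by (simp add: map_f)
    fix i
    show "map f [0..<length (l i)] \<noteq> l i"
    proof
      assume "map f [0..<length (l i)] = l i"
      then have eq: "g (length (l i)) = l i" by (simp add: map_f)
      \<comment> \<open>At the vertex \<open>l i\<close> the cylinder of index \<open>i\<close>
        alone has the weight that the invariant forbids.\<close>
      have "ennreal ((1 / real M) ^ length (l i)) = w (l i) i"
        by (simp add: w_def)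
      also have "\<dots> = sum (w (l i)) {i}"
        by simp
      also have "\<dots> \<le> W (l i)"
        unfolding W_def by (intro sum_le_suminf) auto
      finally show False
        using g(2)[of "length (l i)"] eq by simp
    qed
  qed
qed


section \<open>Laurent series and best denominators\<close>

lemma card_field_gt_1: "1 < CARD('a::{field,finite})"
proof -
  have "card {0, 1 :: 'a} \<le> CARD('a)" by (intro card_mono) auto
  then show ?thesis by simp
qed

lemma laurent_abs_nonneg: "0 \<le> laurent_abs \<theta>"
  by (simp add: laurent_abs_def)

text \<open>The variable stands for \<open>1/t\<close>, so smallness means a long run of vanishing
  initial digits; balls become cylinders in this way.\<close>

lemma laurent_abs_le_iff:
  fixes \<theta> :: "'a::{field,finite} fls"
  shows "laurent_abs \<theta> \<le> real CARD('a) powi (- k) \<longleftrightarrow> (\<forall>i<k. fls_nth \<theta> i = 0)"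
proof (cases "\<theta> = 0")
  case False
  have "laurent_abs \<theta> \<le> real CARD('a) powi (- k) \<longleftrightarrow> k \<le> fls_subdegree \<theta>"
    using False card_field_gt_1[where 'a='a] power_int_strict_increasing[of "- fls_subdegree \<theta>" "- k" "real CARD('a)"]
      power_int_increasing[of "- fls_subdegree \<theta>" "- k" "real CARD('a)"]
      power_int_strict_increasing[of "- k" "- fls_subdegree \<theta>" "real CARD('a)"]
    by (fastforce simp: laurent_abs_def)
  also have "\<dots> \<longleftrightarrow> (\<forall>i<k. fls_nth \<theta> i = 0)"
    using False fls_subdegree_geI[of \<theta> k] by auto
  finally show ?thesis .
qed (simp add: laurent_abs_def)

lemma laurent_abs_ge:
  fixes \<theta> :: "'a::{field,finite} fls"
  assumes "fls_nth \<theta> k \<noteq> 0"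
  shows "real CARD('a) powi (- k) \<le> laurent_abs \<theta>"
  using assms card_field_gt_1[where 'a='a] fls_subdegree_leI[OF assms]
  by (auto simp: laurent_abs_def intro!: power_int_increasing)

lemma laurent_abs_mult:
  fixes \<theta> \<phi> :: "'a::{field,finite} fls"
  shows "laurent_abs (\<theta> * \<phi>) = laurent_abs \<theta> * laurent_abs \<phi>"
proof (cases "\<theta> = 0 \<or> \<phi> = 0")
  case False
  then show ?thesis
    using power_int_add[of "real CARD('a)" "- fls_subdegree \<theta>" "- fls_subdegree \<phi>"]
    by (simp add: laurent_abs_def)
qed (auto simp: laurent_abs_def)

text \<open>The ultrametric inequality: a digit of the difference vanishes where both digits
  vanish.\<close>

lemma laurent_abs_diff_le:
  fixes \<theta> \<phi> :: "'a::{field,finite} fls"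
  shows "laurent_abs (\<theta> - \<phi>) \<le> max (laurent_abs \<theta>) (laurent_abs \<phi>)"
proof (cases "\<theta> = 0 \<or> \<phi> = 0 \<or> \<theta> = \<phi>")
  case False
  define k where "k = min (fls_subdegree \<theta>) (fls_subdegree \<phi>)"
  have "laurent_abs (\<theta> - \<phi>) \<le> real CARD('a) powi (- k)"
    unfolding laurent_abs_le_iff by (auto simp: k_def)
  moreover have "real CARD('a) powi (- k) = laurent_abs \<theta> \<or> real CARD('a) powi (- k) = laurent_abs \<phi>"
    using False by (auto simp: k_def laurent_abs_def min_def)
  ultimately show ?thesis by linarith
qed (auto simp: laurent_abs_def fls_subdegree_minus_sym)

lemma laurent_abs_frac_le:
  fixes \<theta> :: "'a::{field,finite} fls"
  shows "laurent_abs (laurent_frac \<theta>) \<le> laurent_abs \<theta>"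
proof (cases "\<theta> = 0")
  case True
  then have "laurent_frac \<theta> = 0" by (intro fls_eqI) (simp add: laurent_frac_nth)
  then show ?thesis by (simp add: True)
next
  case False
  then have "laurent_abs \<theta> = real CARD('a) powi (- fls_subdegree \<theta>)"
    by (simp add: laurent_abs_def)
  then show ?thesis
    by (simp only:) (auto simp: laurent_abs_le_iff laurent_frac_nth)
qed

section \<open>Multiplication by polynomials and best denominators\<close>

lemma laurent_of_poly_diff: "laurent_of_poly (P - Q) = laurent_of_poly P - laurent_of_poly Q"
  by (intro fls_eqI) (simp add: laurent_of_poly_nth)

lemma laurent_frac_diff: "laurent_frac (\<theta> - \<phi>) = laurent_frac \<theta> - laurent_frac \<phi>"
  by (intro fls_eqI) (simp add: laurent_frac_nth)

text \<open>Multiplication by \<open>t ^ i\<close> moves digits by \<open>i\<close> places, so each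
  digit of the product is a linear form in finitely many consecutive digits of
  \<open>\<theta>\<close>.\<close>

lemma laurent_of_poly_mult_nth:
  fixes \<theta> :: "'a::field fls"
  shows "fls_nth (laurent_of_poly N * \<theta>) k = (\<Sum>i\<le>degree N. coeff N i * fls_nth \<theta> (k + int i))"
proof -
  have sum_nth: "fls_nth (\<Sum>i\<in>I. f i) k = (\<Sum>i\<in>I. fls_nth (f i) k)"
    for f :: "nat \<Rightarrow> 'a fls" and I k
    by (induction I rule: infinite_finite_induct) auto
  have N: "laurent_of_poly N = (\<Sum>i\<le>degree N. fls_const (coeff N i) * fls_X_inv ^ i)"
  proof (intro fls_eqI)
    fix n
    have "(\<Sum>i\<le>degree N. fls_nth (fls_const (coeff N i) * fls_X_inv ^ i) n)
        = (\<Sum>i\<le>degree N. if n \<le> 0 \<and> i = nat (- n) then coeff N i else 0)"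
      by (intro sum.cong) auto
    then show "fls_nth (laurent_of_poly N) n =
        fls_nth (\<Sum>i\<le>degree N. fls_const (coeff N i) * fls_X_inv ^ i) n"
      unfolding sum_nth by (auto simp: laurent_of_poly_nth coeff_eq_0 cong: if_cong)
  qed
  show ?thesis
    by (simp only: N sum_distrib_right sum_nth mult.assoc fls_X_inv_power_times_conv_shift(1)
        fls_mult_const_nth fls_shift_nth)
qed

text \<open>Digits of positive index in the product depend only on digits of \<open>\<theta>\<close>
  of positive index.\<close>

lemma laurent_frac_of_poly_mult:
  "laurent_frac (laurent_of_poly N * laurent_frac \<theta>) = laurent_frac (laurent_of_poly N * \<theta>)"
  by (intro fls_eqI) (simp add: laurent_frac_nth laurent_of_poly_mult_nth)

text \<open>Dirichlet's theorem by the pigeonhole principle: with q the size of the field, there are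
  \<open>q ^ Suc m\<close> polynomials of degree at most \<open>m\<close>, but only
  \<open>q ^ m\<close> values of the first \<open>m\<close> fractional digits. Two colliding
  polynomials are subtracted.\<close>

lemma exists_poly_small_frac:
  fixes \<theta> :: "'a::{field,finite} fls"
  obtains Q :: "'a poly" where "Q \<noteq> 0" "degree Q \<le> m"
    "laurent_abs (laurent_frac (laurent_of_poly Q * \<theta>)) \<le> real CARD('a) powi (- int (Suc m))"
proof -
  define L where "L = {xs :: 'a list. set xs \<subseteq> UNIV \<and> length xs = Suc m}"
  define g where "g = (\<lambda>xs :: 'a list. map (\<lambda>k. fls_nth (laurent_of_poly (Poly xs) * \<theta>) (int k)) [1..<Suc m])"
  have "card (g ` L) \<le> card {xs :: 'a list. set xs \<subseteq> UNIV \<and> length xs = m}"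
    by (intro card_mono finite_lists_length_eq) (auto simp: g_def)
  also have "\<dots> < card L"
    unfolding L_def by (simp only: card_lists_length_eq[OF finite]) (simp add: card_field_gt_1[unfolded One_nat_def])
  finally have "\<not> inj_on g L" by (rule pigeonhole)
  then obtain xs ys where xy: "xs \<in> L" "ys \<in> L" "xs \<noteq> ys" "g xs = g ys"
    by (auto simp: inj_on_def)
  define Q where "Q = Poly xs - Poly ys"
  \<comment> \<open>\<open>Poly\<close> forgets trailing zeros, yet it is injective on lists of one
    fixed length.\<close>
  have "Poly xs \<noteq> Poly ys"
  proof
    assume "Poly xs = Poly ys"
    then have "nth_default 0 xs i = nth_default 0 ys i" for i
      by (metis coeff_Poly_eq)
    then have "xs ! i = ys ! i" if "i < Suc m" for i
      using that xy(1,2) by (metis (mono_tags, lifting) L_def mem_Collect_eq nth_default_nth)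
    with xy show False by (auto simp: L_def intro: nth_equalityI)
  qed
  then have "Q \<noteq> 0" by (simp add: Q_def)
  moreover have "degree Q \<le> m"
    using xy(1,2) by (intro degree_le) (auto simp: Q_def L_def nth_default_def)
  moreover have "fls_nth (laurent_of_poly Q * \<theta>) k = 0" if k: "1 \<le> k" "k \<le> int m" for k
  proof -
    have "nat k \<in> set [1..<Suc m]" using k by auto
    then have "fls_nth (laurent_of_poly (Poly xs) * \<theta>) (int (nat k)) = fls_nth (laurent_of_poly (Poly ys) * \<theta>) (int (nat k))"
      using xy(4) unfolding g_def map_eq_conv by blast
    then show ?thesis using k by (simp add: Q_def laurent_of_poly_diff left_diff_distrib)
  qed
  ultimately show thesis
    by (intro that[of Q]) (auto simp only: laurent_abs_le_iff laurent_frac_nth of_nat_Suc split: if_splits)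
qed

text \<open>
  If \<open>Q d\<close> is the best denominator of degree \<open>d\<close> for \<open>\<theta>\<close>, then for every \<open>N\<close> some \<open>Q d\<close> makes
  \<open>|N| |\<langle>Q d \<theta>\<rangle>|\<close> small, and \<open>Q d \<gamma>\<close> differs from \<open>N (Q d \<theta>)\<close> by \<open>Q d (N \<theta> - \<gamma>)\<close>.
\<close>

lemma BA_I:
  fixes \<theta> \<gamma> :: "'a::{field,finite} fls" and Q :: "nat \<Rightarrow> 'a poly"
  assumes deg: "\<And>d. Q d \<noteq> 0" "\<And>d. degree (Q d) = d"
    and best: "\<And>d P. P \<noteq> 0 \<Longrightarrow> degree P = d \<Longrightarrow>
      laurent_abs (laurent_frac (laurent_of_poly (Q d) * \<theta>)) \<le> laurent_abs (laurent_frac (laurent_of_poly P * \<theta>))"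
    and far: "\<And>d. real CARD('a) powi (- int c) \<le> laurent_abs (laurent_frac (laurent_of_poly (Q d) * \<gamma>))"
  shows "\<gamma> \<in> BA \<theta>"
proof -
  let ?q = "real CARD('a)"
  have q: "?q > 1" using card_field_gt_1[where 'a='a] by simp
  have bound: "?q powi (- int (2 * c))
      \<le> laurent_abs (laurent_of_poly N) * laurent_abs (laurent_frac (laurent_of_poly N * \<theta> - \<gamma>))"
    if N: "N \<noteq> 0" for N :: "'a poly"
  proof -
    define n where "n = degree N"
    define x where "x = laurent_of_poly N * \<theta> - \<gamma>"
    \<comment> \<open>The degree bound \<open>n + c\<close> makes the product with
      \<open>|N| = q ^ n\<close> at most \<open>q powi (- c - 1)\<close>, strictly below the bound
      in \<open>far\<close>.\<close>
    obtain P :: "'a poly" where P: "P \<noteq> 0" "degree P \<le> n + c"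
      "laurent_abs (laurent_frac (laurent_of_poly P * \<theta>)) \<le> ?q powi (- int (Suc (n + c)))"
      by (rule exists_poly_small_frac)
    \<comment> \<open>\<open>best\<close> compares polynomials of one degree only, so
      \<open>d\<close> is the exact degree of \<open>P\<close>, which may be less than
      \<open>n + c\<close>.\<close>
    define d where "d = degree P"
    let ?Q = "laurent_of_poly (Q d)"
    define y where "y = laurent_frac (?Q * \<theta>)"
    have "laurent_abs y \<le> ?q powi (- int (Suc (n + c)))"
      using best[OF P(1), of d] P(3) by (simp add: d_def y_def)
    then have "laurent_abs (laurent_of_poly N * y) \<le> ?q ^ n * ?q powi (- int (Suc (n + c)))"
      using N by (simp add: laurent_abs_mult laurent_abs_of_poly n_def)
    also have "\<dots> = ?q powi (- int c - 1)"
      using q by (subst power_int_of_nat[symmetric], subst power_int_add[symmetric]) auto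
    also have "\<dots> < ?q powi (- int c)"
      using q by (intro power_int_strict_increasing) auto
    finally have Ny: "laurent_abs (laurent_frac (laurent_of_poly N * y)) < ?q powi (- int c)"
      using laurent_abs_frac_le order.strict_trans1 by blast
    have "?Q * \<gamma> = laurent_of_poly N * (?Q * \<theta>) - ?Q * x"
      by (simp add: x_def algebra_simps)
    then have "laurent_frac (?Q * \<gamma>) = laurent_frac (laurent_of_poly N * y) - laurent_frac (?Q * laurent_frac x)"
      by (simp only: laurent_frac_diff y_def laurent_frac_of_poly_mult)
    \<comment> \<open>By the ultrametric inequality the second term must be large, as the first is
      too small. The factor \<open>|Q d|\<close> then costs at most \<open>q ^ (n + c)\<close>, of
      which \<open>q ^ n\<close> is absorbed by \<open>|N|\<close>; hence the exponent
      \<open>2 * c\<close>.\<close>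
    then have "?q powi (- int c) \<le> laurent_abs (laurent_frac (?Q * laurent_frac x))"
      using far[of d] Ny laurent_abs_diff_le by (smt (verit))
    also have "\<dots> \<le> laurent_abs (?Q * laurent_frac x)"
      by (rule laurent_abs_frac_le)
    also have "\<dots> = ?q ^ d * laurent_abs (laurent_frac x)"
      using deg[of d] by (simp add: laurent_abs_mult laurent_abs_of_poly)
    also have "\<dots> \<le> ?q ^ (n + c) * laurent_abs (laurent_frac x)"
      using q P(2) by (intro mult_right_mono power_increasing laurent_abs_nonneg) (auto simp: d_def)
    finally have "?q powi (- int c) / ?q ^ c \<le> ?q ^ n * laurent_abs (laurent_frac x)"
      using q by (simp add: power_add field_simps)
    also have "?q powi (- int c) / ?q ^ c = ?q powi (- int (2 * c))"
      unfolding power_int_minus power_int_of_nat by (simp add: mult_2 power_add divide_simps)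
    finally show ?thesis
      using N by (simp add: laurent_abs_of_poly n_def x_def)
  qed
  have "?q powi (- int (2 * c)) \<le> approx_const \<theta> \<gamma>"
    unfolding approx_const_def
  proof (rule cINF_greatest)
    have "1 \<in> {N :: 'a poly. N \<noteq> 0}" by simp
    then show "{N :: 'a poly. N \<noteq> 0} \<noteq> {}" by blast
  qed (use bound in blast)
  moreover have "?q powi (- int (2 * c)) > 0" using q by simp
  ultimately have "0 < approx_const \<theta> \<gamma>" by linarith
  then show ?thesis by (simp add: BA_def)
qed

text \<open>Over a finite field only finitely many polynomials have a given degree, so the minimum
  is attained.\<close>

lemma exists_best_polys:
  fixes \<theta> :: "'a::{field,finite} fls"
  obtains Q :: "nat \<Rightarrow> 'a poly" where "\<And>d. Q d \<noteq> 0" "\<And>d. degree (Q d) = d"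
    "\<And>d P. P \<noteq> 0 \<Longrightarrow> degree P = d \<Longrightarrow>
      laurent_abs (laurent_frac (laurent_of_poly (Q d) * \<theta>)) \<le> laurent_abs (laurent_frac (laurent_of_poly P * \<theta>))"
proof -
  have "\<exists>Q :: 'a poly. (Q \<noteq> 0 \<and> degree Q = d) \<and> (\<forall>P. P \<noteq> 0 \<longrightarrow> degree P = d \<longrightarrow>
      laurent_abs (laurent_frac (laurent_of_poly Q * \<theta>)) \<le> laurent_abs (laurent_frac (laurent_of_poly P * \<theta>)))"
    for d
  proof -
    let ?S = "{P :: 'a poly. P \<noteq> 0 \<and> degree P = d}"
    have "?S \<subseteq> Poly ` {xs. set xs \<subseteq> UNIV \<and> length xs = Suc d}"
    proof
      fix P assume "P \<in> ?S"
      then have "Poly (coeffs P) = P" "length (coeffs P) = Suc d"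
        by (auto simp: length_coeffs_degree)
      then show "P \<in> Poly ` {xs. set xs \<subseteq> UNIV \<and> length xs = Suc d}"
        by (metis (mono_tags, lifting) image_eqI mem_Collect_eq subset_UNIV)
    qed
    then have "finite ?S"
      using finite_lists_length_eq[OF finite, of UNIV "Suc d"] finite_subset by blast
    moreover have "monom 1 d \<in> ?S" by (simp add: degree_monom_eq)
    then have "?S \<noteq> {}" by blast
    ultimately show ?thesis
      using arg_min_if_finite[of ?S "\<lambda>P. laurent_abs (laurent_frac (laurent_of_poly P * \<theta>))"]
      by (intro exI[of _ "arg_min_on (\<lambda>P. laurent_abs (laurent_frac (laurent_of_poly P * \<theta>))) ?S"])
        (auto simp: not_less)
  qed
  then show thesis using that by metis
qed


section \<open>The Cantor set\<close>

lemma hausdorff_measure_laurent_eq_0: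
  fixes A :: "'a::{field,finite} fls set"
  assumes s: "s > 1"
  shows "hausdorff_measure laurent_dist s A = 0"
proof -
  let ?q = "real CARD('a)"
  have q: "?q > 1" using card_field_gt_1[where 'a='a] by simp
  \<comment> \<open>\<open>B k\<close> is the ball of radius \<open>?q ^ k\<close> around 0; these
    balls exhaust the field.\<close>
  define B where "B = (\<lambda>k::nat. {x :: 'a fls. \<forall>i < - int k. fls_nth x i = 0})"
  \<comment> \<open>Fixing the \<open>k + m\<close> digits of indices \<open>-k\<close> to
    \<open>m - 1\<close> cuts the ball into \<open>?q ^ (k + m)\<close> cells of diameter at most
    \<open>(1 / ?q) ^ m\<close>. Their total cost tends to 0 as \<open>m\<close> grows because
    \<open>s > 1\<close>.\<close>
  have B_le: "hausdorff_premeasure laurent_dist s \<delta> (B k) \<le> ennreal (?q ^ k * (?q powr (1 - s)) ^ m)"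
    if \<delta>: "(1 / ?q) ^ m \<le> \<delta>" for \<delta> k m
  proof -
    define I where "I = {xs :: 'a list. set xs \<subseteq> UNIV \<and> length xs = k + m}"
    define U where "U = (\<lambda>xs. {x \<in> B k. map (\<lambda>j. fls_nth x (int j - int k)) [0..<k + m] = xs})"
    have "hausdorff_premeasure laurent_dist s \<delta> (B k) \<le> ennreal (real (card I) * ((1 / ?q) ^ m) powr s)"
    proof (rule hausdorff_premeasure_le_finite[where U = U])
      show "finite I" unfolding I_def by (rule finite_lists_length_eq) simp
      show "B k \<subseteq> (\<Union>xs\<in>I. U xs)" by (auto simp: U_def I_def)
      show "diam_wrt laurent_dist (U xs) \<le> ennreal ((1 / ?q) ^ m)" for xs
      proof -
        have "laurent_dist x y \<le> (1 / ?q) ^ m" if x: "x \<in> U xs" and y: "y \<in> U xs" for x y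
        proof -
          have "fls_nth (x - y) i = 0" if i: "i < int m" for i
          proof (cases "i < - int k")
            case True
            then show ?thesis using x y by (simp add: U_def B_def)
          next
            case False
            define j where "j = nat (i + int k)"
            have j: "j < k + m" "i = int j - int k" using False i by (auto simp: j_def)
            have "map (\<lambda>j. fls_nth x (int j - int k)) [0..<k + m] ! j
                = map (\<lambda>j. fls_nth y (int j - int k)) [0..<k + m] ! j"
              using x y by (simp add: U_def)
            then show ?thesis using j by simp
          qed
          then have "laurent_abs (x - y) \<le> ?q powi (- int m)"
            by (simp add: laurent_abs_le_iff)
          then show ?thesis
            by (simp add: laurent_dist_def power_int_minus power_one_over inverse_eq_divide)
        qed
        then show ?thesis
          unfolding diam_wrt_def by (intro SUP_least) (auto intro: ennreal_leI)
      qed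
    qed (use \<delta> s in auto)
    also have "card I = CARD('a) ^ (k + m)"
      unfolding I_def by (rule card_lists_length_eq) simp
    also have "((1 / ?q) ^ m) powr s = (?q powr (- s)) ^ m"
      using q by (simp add: powr_power powr_powr powr_minus_divide powr_divide power_one_over
          mult.commute flip: powr_realpow)
    also have "real (CARD('a) ^ (k + m)) * (?q powr (- s)) ^ m = ?q ^ k * (?q powr (1 - s)) ^ m"
      using q by (simp add: power_add powr_diff powr_minus field_simps)
    finally show ?thesis .
  qed
  have "hausdorff_premeasure laurent_dist s \<delta> (B k) = 0" if "\<delta> > 0" for \<delta> k
  proof -
    have "?q powr (1 - s) < 1"
      using q s powr_less_mono[of "1 - s" 0 ?q] by simp
    then have "(\<lambda>m. ?q ^ k * (?q powr (1 - s)) ^ m) \<longlonglongrightarrow> ?q ^ k * 0"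
      by (intro tendsto_mult_left LIMSEQ_power_zero) simp
    then have "(\<lambda>m. ennreal (?q ^ k * (?q powr (1 - s)) ^ m)) \<longlonglongrightarrow> ennreal 0"
      by (intro tendsto_ennrealI) simp
    moreover have "(\<lambda>m. (1 / ?q) ^ m) \<longlonglongrightarrow> 0"
      using q by (intro LIMSEQ_power_zero) simp
    then have "\<forall>\<^sub>F m in sequentially. (1 / ?q) ^ m < \<delta>"
      using that by (rule order_tendstoD)
    then have "\<forall>\<^sub>F m in sequentially. hausdorff_premeasure laurent_dist s \<delta> (B k)
        \<le> ennreal (?q ^ k * (?q powr (1 - s)) ^ m)"
      by eventually_elim (intro B_le less_imp_le)
    ultimately have "hausdorff_premeasure laurent_dist s \<delta> (B k) \<le> ennreal 0"
      by (intro tendsto_lowerbound) auto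
    then show ?thesis by simp
  qed
  moreover have "A \<subseteq> (\<Union>k. B k)"
  proof
    fix x :: "'a fls"
    have "x \<in> B (nat (- fls_subdegree x))" by (auto simp: B_def)
    then show "x \<in> (\<Union>k. B k)" by blast
  qed
  ultimately have "hausdorff_premeasure laurent_dist s \<delta> A = 0" if "\<delta> > 0" for \<delta>
    using that hausdorff_premeasure_UN_eq_0[of laurent_dist s \<delta> B]
      hausdorff_premeasure_mono[of A "\<Union>k. B k" laurent_dist s \<delta>] by simp
  then have "hausdorff_measure laurent_dist s A \<le> 0"
    unfolding hausdorff_measure_def by (intro SUP_least) simp
  then show ?thesis by simp
qed

section \<open>Series made of digit blocks and the Cantor set\<close>

lemma laurent_of_poly_mult_nth_eq_iff:
  fixes x y :: "'a::field fls"
  assumes "Q \<noteq> 0" "degree Q = d" and "\<And>i. i < d \<Longrightarrow> fls_nth x (k + int i) = fls_nth y (k + int i)"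
  shows "fls_nth (laurent_of_poly Q * x) k = fls_nth (laurent_of_poly Q * y) k
    \<longleftrightarrow> fls_nth x (k + int d) = fls_nth y (k + int d)"
proof -
  \<comment> \<open>The digit of index \<open>k + d\<close> enters only through the last term, with
    the nonzero leading coefficient as factor.\<close>
  have "fls_nth (laurent_of_poly Q * z) k
      = (\<Sum>i<d. coeff Q i * fls_nth z (k + int i)) + lead_coeff Q * fls_nth z (k + int d)" for z
    by (simp add: laurent_of_poly_mult_nth assms(2) flip: lessThan_Suc_atMost)
  moreover have "lead_coeff Q \<noteq> 0"
    using assms(1) by simp
  ultimately show ?thesis
    using assms(3) by simp
qed

text \<open>
  The first block starts at the exponent 0 of \<^const>\<open>fls_X\<close>, which the fractional part ignores.
\<close>

definition block_series :: "nat \<Rightarrow> (nat \<Rightarrow> 'a::zero list) \<Rightarrow> 'a fls" where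
  "block_series c f = fps_to_fls (Abs_fps (\<lambda>n. f (n div c) ! (n mod c)))"

lemma block_series_nth:
  "fls_nth (block_series c f) i = (if i < 0 then 0 else f (nat i div c) ! (nat i mod c))"
  by (simp add: block_series_def)

lemma block_series_cong:
  assumes "\<And>n. n < J \<Longrightarrow> f n = g n" and "i < int (c * J)"
  shows "fls_nth (block_series c f) i = fls_nth (block_series c g) i"
proof (cases "i < 0")
  case False
  with assms(2) have "nat i < J * c" by (simp add: mult.commute nat_less_iff)
  then have "nat i div c < J" by (simp add: less_mult_imp_div_less)
  then show ?thesis using assms(1) by (simp add: block_series_nth)
qed (simp add: block_series_nth)

lemma block_series_block:
  assumes "r < c"
  shows "fls_nth (block_series c f) (int (c * n + r)) = f n ! r"
  using assms by (simp add: block_series_nth nat_add_distrib nat_mult_distrib del: of_nat_add of_nat_mult)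

lemma block_series_eqD:
  assumes "\<And>i. i < int (c * J) \<Longrightarrow> fls_nth (block_series c f) i = fls_nth (block_series c g) i"
    and "length (f n) = c" "length (g n) = c" and n: "n < J"
  shows "f n = g n"
proof (rule nth_equalityI)
  fix r assume "r < length (f n)"
  then have r: "r < c" using assms(2) by simp
  have "c * n + r < c * Suc n" using r by simp
  also have "\<dots> \<le> c * J" using n by (intro mult_le_mono2) simp
  finally show "f n ! r = g n ! r"
    using assms(1)[of "int (c * n + r)"] r by (simp only: block_series_block of_nat_less_iff)
qed (simp add: assms)

text \<open>
  Digit \<open>c * j + r - d\<close> of \<open>Q \<gamma>\<close> is a nonzero multiple of digit \<open>c * j + r\<close> of \<open>\<gamma>\<close> plus a
  combination of earlier digits of \<open>\<gamma>\<close>.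
\<close>

lemma block_unique:
  fixes Q :: "'a::field poly"
  assumes Q: "Q \<noteq> 0" "degree Q = d" and d: "d \<le> c * length v"
    and b: "length b = c" "length b' = c"
    and zero: "\<And>p. d + p < c * Suc (length v) \<Longrightarrow> p + d \<ge> c * length v \<Longrightarrow>
      fls_nth (laurent_of_poly Q * block_series c ((!) (v @ [b]))) (int p)
      = fls_nth (laurent_of_poly Q * block_series c ((!) (v @ [b']))) (int p)"
  shows "b = b'"
proof (rule nth_equalityI)
  fix r assume "r < length b"
  then show "b ! r = b' ! r"
  proof (induction r rule: less_induct)
    case (less r)
    let ?x = "\<lambda>b. block_series c ((!) (v @ [b]))"
    define p where "p = c * length v + r - d"
    have p': "p + d = c * length v + r" using d by (simp add: p_def)
    then have p: "int p + int d = int (c * length v + r)" by (simp only: flip: of_nat_add)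
    have r: "r < c" using less.prems b by simp
    \<comment> \<open>Such a digit lies either in the common blocks \<open>v\<close> or at a place
      \<open>r' < r\<close> of the last block, where the induction hypothesis applies.\<close>
    have agree: "fls_nth (?x b) (int p + int i) = fls_nth (?x b') (int p + int i)" if "i < d" for i
    proof (cases "int p + int i < int (c * length v)")
      case True
      then show ?thesis by (intro block_series_cong[of "length v"]) (auto simp: nth_append)
    next
      case False
      define r' where "r' = p + i - c * length v"
      have "c * length v \<le> p + i"
        using False by (simp only: not_less of_nat_le_iff flip: of_nat_add)
      then have "p + i = c * length v + r'" by (simp add: r'_def)
      with p' have "int p + int i = int (c * length v + r')" "r' < r"
        using that by (simp_all only: flip: of_nat_add)
      then show ?thesis
        using less.IH[of r'] r b by (simp only: block_series_block) (simp add: nth_append)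
    qed
    have "fls_nth (laurent_of_poly Q * ?x b) (int p) = fls_nth (laurent_of_poly Q * ?x b') (int p)"
      using p' r by (intro zero) auto
    then have "fls_nth (?x b) (int p + int d) = fls_nth (?x b') (int p + int d)"
      using laurent_of_poly_mult_nth_eq_iff[OF Q agree] by blast
    then show ?case
      unfolding p using r by (simp only: block_series_block) (simp add: nth_append)
  qed
qed (simp add: b)

text \<open>
  The block following \<open>v\<close> takes care of the denominators \<open>Q d\<close> with \<open>d\<close> in the last block of
  exponents of \<open>v\<close>; each of them rules out at most one value.
\<close>

definition good_blocks :: "(nat \<Rightarrow> 'a::field poly) \<Rightarrow> nat \<Rightarrow> 'a list list \<Rightarrow> 'a list set" where
  "good_blocks Q c v = {b. length b = c \<and> (\<forall>d. Suc (d div c) = length v \<longrightarrow>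
     (\<exists>p\<ge>1. d + p < c * Suc (length v) \<and>
       fls_nth (laurent_of_poly (Q d) * block_series c ((!) (v @ [b]))) (int p) \<noteq> 0))}"

lemma finite_good_blocks: "finite (good_blocks Q c (v :: 'a::{field,finite} list list))"
  by (rule finite_subset[OF _ finite_lists_length_eq[OF finite, of UNIV c]]) (auto simp: good_blocks_def)

text \<open>A union bound: at most \<open>c\<close> degrees are to be handled, and by
  \<open>block_unique\<close> each excludes at most one block.\<close>

lemma card_good_blocks:
  fixes Q :: "nat \<Rightarrow> 'a::{field,finite} poly"
  assumes Q: "\<And>d. Q d \<noteq> 0" "\<And>d. degree (Q d) = d" and c: "c > 0"
  shows "CARD('a) ^ c - c \<le> card (good_blocks Q c v)"
proof -
  define L where "L = {b :: 'a list. set b \<subseteq> UNIV \<and> length b = c}"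
  \<comment> \<open>For \<open>v = []\<close> this set is empty, so the first block is free.\<close>
  define D where "D = {d. Suc (d div c) = length v}"
  define F where "F = (\<lambda>d. {b \<in> L. \<forall>p\<ge>1. d + p < c * Suc (length v) \<longrightarrow>
    fls_nth (laurent_of_poly (Q d) * block_series c ((!) (v @ [b]))) (int p) = 0})"
  have finL: "finite L" unfolding L_def by (rule finite_lists_length_eq) simp
  have D: "D \<subseteq> {c * (length v - 1)..<c * length v}"
  proof
    fix d assume "d \<in> D"
    then have j: "length v = Suc (d div c)" by (simp add: D_def)
    have "c * (d div c) \<le> d" "d < c * Suc (d div c)"
      using c by (simp_all add: dividend_less_times_div)
    then show "d \<in> {c * (length v - 1)..<c * length v}" by (simp add: j)
  qed
  then have "card D \<le> c * length v - c * (length v - 1)"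
    using card_mono[OF _ D] by simp
  also have "\<dots> \<le> c * 1"
    unfolding diff_mult_distrib2[symmetric] by (intro mult_le_mono2) simp
  finally have cardD: "card D \<le> c" by simp
  have cardF: "card (F d) \<le> 1" if "d \<in> D" for d
  proof -
    have d: "d < c * length v" using that D by auto
    have "b = b'" if "b \<in> F d" "b' \<in> F d" for b b'
    proof (rule block_unique[OF Q, of d])
      show "d \<le> c * length v" using d by simp
      show "length b = c" "length b' = c" using that by (auto simp: F_def L_def)
      fix p assume "d + p < c * Suc (length v)" "p + d \<ge> c * length v"
      \<comment> \<open>This is why \<open>d\<close> is handled one block late: every digit of the
        new block is then the last one to enter some digit \<open>p \<ge> 1\<close> of the product,
        which the fractional part keeps.\<close>
      moreover from this have "p \<ge> 1" using d by simp
      ultimately show "fls_nth (laurent_of_poly (Q d) * block_series c ((!) (v @ [b]))) (int p)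
          = fls_nth (laurent_of_poly (Q d) * block_series c ((!) (v @ [b']))) (int p)"
        using that by (simp add: F_def)
    qed
    then show ?thesis
      using finite_subset[OF _ finL, of "F d"] by (auto simp: F_def card_le_Suc0_iff_eq)
  qed
  have finD: "finite D" using D finite_subset by blast
  have "L \<subseteq> good_blocks Q c v \<union> (\<Union>d\<in>D. F d)"
    by (auto simp: good_blocks_def L_def D_def F_def)
  then have "card L \<le> card (good_blocks Q c v \<union> (\<Union>d\<in>D. F d))"
    using finD finL by (intro card_mono) (auto simp: finite_good_blocks F_def)
  also have "\<dots> \<le> card (good_blocks Q c v) + card (\<Union>d\<in>D. F d)"
    by (rule card_Un_le)
  also have "card (\<Union>d\<in>D. F d) \<le> (\<Sum>d\<in>D. card (F d))"
    using finD by (rule card_UN_le)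
  also have "\<dots> \<le> card D"
    using sum_mono[OF cardF, of D "\<lambda>d. d"] by simp
  also have "card L = CARD('a) ^ c"
    unfolding L_def by (rule card_lists_length_eq) simp
  finally show ?thesis using cardD by simp
qed

lemma block_series_in_BA:
  fixes \<theta> :: "'a::{field,finite} fls"
  assumes Q: "\<And>d. Q d \<noteq> 0" "\<And>d. degree (Q d) = d"
    "\<And>d P. P \<noteq> 0 \<Longrightarrow> degree P = d \<Longrightarrow>
      laurent_abs (laurent_frac (laurent_of_poly (Q d) * \<theta>)) \<le> laurent_abs (laurent_frac (laurent_of_poly P * \<theta>))"
    and f: "\<And>n. f n \<in> good_blocks Q c (map f [0..<n])"
  shows "block_series c f \<in> BA \<theta>"
proof (rule BA_I[OF Q])
  fix d
  define j where "j = Suc (d div c)"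
  let ?v = "map f [0..<j] @ [f j]"
  obtain p where p: "p \<ge> 1" "d + p < c * Suc j"
    "fls_nth (laurent_of_poly (Q d) * block_series c ((!) ?v)) (int p) \<noteq> 0"
    using f[of j] by (auto simp: good_blocks_def j_def)
  have "?v = map f [0..<Suc j]" by simp
  then have v: "?v ! n = f n" if "n < Suc j" for n
    using that by (simp only: nth_map_upt) simp
  \<comment> \<open>As \<open>d + p < c * Suc j\<close>, all digits used lie in the first
    \<open>Suc j\<close> blocks; the unspecified values of \<open>(!) ?v\<close> past its end never
    enter.\<close>
  have "fls_nth (laurent_of_poly (Q d) * block_series c ((!) ?v)) (int p)
      = fls_nth (laurent_of_poly (Q d) * block_series c f) (int p)"
    unfolding laurent_of_poly_mult_nth using p(2) v Q(2)[of d]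
    by (intro sum.cong arg_cong2[of _ _ _ _ "(*)"] block_series_cong[of "Suc j"])
      (auto simp del: of_nat_mult of_nat_add simp flip: of_nat_add)
  then have "fls_nth (laurent_frac (laurent_of_poly (Q d) * block_series c f)) (int p) \<noteq> 0"
    using p by (simp add: laurent_frac_nth)
  then have "real CARD('a) powi (- int p)
      \<le> laurent_abs (laurent_frac (laurent_of_poly (Q d) * block_series c f))"
    by (rule laurent_abs_ge)
  \<comment> \<open>\<open>d\<close> is not before the start of its block, and \<open>d + p\<close>
    is before the end of the next block; hence the constant \<open>2 * c\<close>, uniform in
    \<open>d\<close>.\<close>
  moreover have "p \<le> 2 * c"
  proof -
    have "c * (d div c) \<le> d" by simp
    then show ?thesis using p(2) unfolding j_def mult_Suc_right by linarith
  qed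
  then have "real CARD('a) powi (- int (2 * c)) \<le> real CARD('a) powi (- int p)"
    using card_field_gt_1[where 'a='a] by (intro power_int_increasing) auto
  ultimately show "real CARD('a) powi (- int (2 * c))
      \<le> laurent_abs (laurent_frac (laurent_of_poly (Q d) * block_series c f))"
    by linarith
qed

section \<open>Choice of parameters and the lower bound for the dimension\<close>

lemma exists_block_length:
  fixes q s :: real
  assumes q: "q > 1" and s: "s < 1"
  obtains c :: nat where "c > 0" "q powr (real c * s) \<le> q ^ c - real c"
proof -
  have "q powr (s - 1) < 1"
    using q s powr_less_mono[of "s - 1" 0 q] by simp
  \<comment> \<open>After division by \<open>q ^ c\<close> the claim is that this sum is at most 1;
    both terms tend to 0.\<close>
  then have "(\<lambda>c. (q powr (s - 1)) ^ c + real c * (1 / q) ^ c) \<longlonglongrightarrow> 0 + 0"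
    using q by (intro tendsto_add LIMSEQ_power_zero powser_times_n_limit_0) auto
  then have "\<forall>\<^sub>F c in sequentially. (q powr (s - 1)) ^ c + real c * (1 / q) ^ c < 1"
    by (intro order_tendstoD) auto
  then have "\<forall>\<^sub>F c in sequentially. c > 0 \<and> (q powr (s - 1)) ^ c + real c * (1 / q) ^ c < 1"
    using eventually_gt_at_top by (rule eventually_conj[rotated])
  then obtain c :: nat where c: "c > 0" "(q powr (s - 1)) ^ c + real c * (1 / q) ^ c < 1"
    by (auto simp: eventually_sequentially)
  have "q ^ c * (q powr (s - 1)) ^ c = q powr real c * q powr (real c * (s - 1))"
    using q by (simp add: powr_realpow powr_power mult.commute)
  also have "\<dots> = q powr (real c * s)"
    by (simp add: right_diff_distrib flip: powr_add)
  finally have "q powr (real c * s) = q ^ c * (q powr (s - 1)) ^ c" ..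
  moreover have "real c = q ^ c * (real c * (1 / q) ^ c)"
    using q by (simp add: power_one_over)
  moreover have "q ^ c * (q powr (s - 1)) ^ c + q ^ c * (real c * (1 / q) ^ c) \<le> q ^ c * 1"
    unfolding distrib_left[symmetric] using q c(2) by (intro mult_left_mono) auto
  ultimately have "q powr (real c * s) \<le> q ^ c - real c"
    by linarith
  with c(1) show thesis by (rule that)
qed

text \<open>For \<open>r > 0\<close>, \<open>J\<close> is the largest exponent with
  \<open>r \<le> (1 / a) ^ J\<close>; the next power is below \<open>r\<close>, so only a factor
  \<open>a powr s\<close> is lost. For \<open>r = 0\<close> there is no largest one, and
  \<open>\<eta>\<close> leaves room for a long cylinder of small weight.\<close>

lemma exists_cylinder_length:
  fixes a M r s \<eta> :: real
  assumes a: "a > 1" and s: "s > 0" and M: "a powr s \<le> M" and r: "0 \<le> r" "r \<le> 1" and \<eta>: "\<eta> > 0"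
  obtains J :: nat where "r \<le> (1 / a) ^ J" "(1 / M) ^ J \<le> a powr s * r powr s + \<eta>"
proof (cases "r = 0")
  case True
  have "1 < a powr s" using a s by simp
  then have "M > 1" using M by linarith
  then obtain J where "(1 / M) ^ J < \<eta>"
    using real_arch_pow_inv[OF \<eta>, of "1 / M"] by auto
  then show thesis
    using a s True by (intro that[of J]) auto
next
  case False
  have "\<exists>n. (1 / a) ^ n < r"
    using False r a by (intro real_arch_pow_inv) auto
  then have lt: "(1 / a) ^ (LEAST n. (1 / a) ^ n < r) < r"
    by (rule LeastI_ex)
  obtain J where J: "(LEAST n. (1 / a) ^ n < r) = Suc J"
    using lt r(2) by (cases "LEAST n. (1 / a) ^ n < r") auto
  show thesis
  proof (rule that[of J])
    show "r \<le> (1 / a) ^ J"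
      using not_less_Least[of J "\<lambda>n. (1 / a) ^ n < r"] J by (simp add: not_less)
    have pos: "0 < a powr s" using a by simp
    then have "0 < M" using M by linarith
    with pos M have "(1 / M) ^ J \<le> (1 / a powr s) ^ J"
      by (intro power_mono divide_left_mono mult_pos_pos) simp_all
    also have "\<dots> = a powr s * ((1 / a) ^ Suc J) powr s"
      using a by (simp add: powr_divide powr_mult powr_power powr_powr
          field_simps flip: powr_realpow)
    also have "\<dots> \<le> a powr s * r powr s"
      using lt J s a by (intro mult_left_mono powr_mono2) auto
    finally show "(1 / M) ^ J \<le> a powr s * r powr s + \<eta>" using \<eta> by simp
  qed
qed

text \<open>A cheap cover would yield cylinders of total weight below 1, and a branch avoiding them
  gives a point of \<open>BA \<theta>\<close> outside the cover.\<close>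

lemma hausdorff_premeasure_BA_neq_0:
  fixes \<theta> :: "'a::{field,finite} fls"
  assumes s: "0 < s" "s < 1"
  shows "hausdorff_premeasure laurent_dist s 1 (BA \<theta>) \<noteq> 0"
proof
  assume 0: "hausdorff_premeasure laurent_dist s 1 (BA \<theta>) = 0"
  let ?q = "real CARD('a)"
  have q: "?q > 1" using card_field_gt_1[where 'a='a] by simp
  obtain c :: nat where c: "c > 0" "?q powr (real c * s) \<le> ?q ^ c - real c"
    using exists_block_length[OF q s(2)] .
  obtain Q :: "nat \<Rightarrow> 'a poly" where Q: "\<And>d. Q d \<noteq> 0" "\<And>d. degree (Q d) = d"
    "\<And>d P. P \<noteq> 0 \<Longrightarrow> degree P = d \<Longrightarrow>
      laurent_abs (laurent_frac (laurent_of_poly (Q d) * \<theta>)) \<le> laurent_abs (laurent_frac (laurent_of_poly P * \<theta>))"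
    by (rule exists_best_polys[of \<theta>]) blast
  define a where "a = ?q ^ c"
  define M where "M = CARD('a) ^ c - c"
  have a: "a > 1" using q c(1) by (simp add: a_def)
  have as: "a powr s = ?q powr (real c * s)"
    using q by (simp add: a_def powr_powr flip: powr_realpow)
  have "0 < ?q powr (real c * s)" using q by simp
  then have "real c < real (CARD('a) ^ c)" using c(2) unfolding of_nat_power by linarith
  then have "c < CARD('a) ^ c" by (simp only: of_nat_less_iff)
  then have "M > 0" "real M = ?q ^ c - real c"
    by (simp_all add: M_def)
  then have M: "M > 0" "a powr s \<le> real M"
    using c(2) as by simp_all
  define K where "K = a powr s"
  have K: "K > 0" using a by (simp add: K_def)
  \<comment> \<open>This threshold keeps the sum of the terms \<open>K * r i powr s\<close> below
    one half; the errors \<open>?\<eta> i\<close> sum to the other half.\<close>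
  obtain U where U: "BA \<theta> \<subseteq> (\<Union>i. U i)" "\<And>i. diam_wrt laurent_dist (U i) \<le> ennreal 1"
    "(\<Sum>i. ennreal (enn2real (diam_wrt laurent_dist (U i)) powr s)) < ennreal (1 / (2 * K))"
    by (rule hausdorff_premeasure_lessE[of laurent_dist s 1 "BA \<theta>" "ennreal (1 / (2 * K))"])
      (use 0 K in auto)
  define r where "r = (\<lambda>i. enn2real (diam_wrt laurent_dist (U i)))"
  have r: "0 \<le> r i" "r i \<le> 1" for i
    using U(2)[of i] by (auto simp: r_def intro: enn2real_leI)
  have dist_le: "laurent_dist x y \<le> r i" if "x \<in> U i" "y \<in> U i" for x y i
  proof -
    have "ennreal (laurent_dist x y) \<le> diam_wrt laurent_dist (U i)"
      unfolding diam_wrt_def using that by (intro SUP_upper2[of "(x, y)"]) auto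
    also have "\<dots> = ennreal (r i)"
      using le_less_trans[OF U(2)[of i] ennreal_less_top] by (simp add: r_def)
    finally show ?thesis
      using r by (simp add: laurent_dist_def laurent_abs_nonneg)
  qed
  let ?\<eta> = "\<lambda>i. 1 / 2 * (1 / 2 :: real) ^ Suc i"
  have "\<exists>J. r i \<le> (1 / a) ^ J \<and> (1 / real M) ^ J \<le> K * r i powr s + ?\<eta> i" for i
    unfolding K_def
    by (rule exists_cylinder_length[OF a s(1) M(2) r, of "?\<eta> i"]) auto
  then obtain J where J: "\<And>i. r i \<le> (1 / a) ^ J i"
    "\<And>i. (1 / real M) ^ J i \<le> K * r i powr s + ?\<eta> i"
    by metis
  \<comment> \<open>Two block series in \<open>U i\<close> differ by at most
    \<open>(1 / a) ^ J i\<close>, hence share their first \<open>J i\<close> blocks. If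
    \<open>U i\<close> contains no block series, any word of that length will do.\<close>
  have "\<exists>l. length l = J i \<and> (\<forall>f. (\<forall>n. length (f n) = c) \<longrightarrow> block_series c f \<in> U i \<longrightarrow>
      map f [0..<J i] = l)" for i
  proof (cases "\<exists>g. (\<forall>n. length (g n) = c) \<and> block_series c g \<in> U i")
    case False
    then show ?thesis by (intro exI[of _ "replicate (J i) []"]) auto
  next
    case True
    then obtain g where g: "\<And>n. length (g n) = c" "block_series c g \<in> U i" by blast
    have "f n = g n" if f: "\<And>n. length (f n) = c" "block_series c f \<in> U i" and n: "n < J i" for f n
    proof (rule block_series_eqD[OF _ f(1) g(1) n])
      fix k assume k: "k < int (c * J i)"
      have "laurent_abs (block_series c f - block_series c g) \<le> (1 / a) ^ J i"
        using dist_le[OF f(2) g(2)] J(1)[of i] by (simp add: laurent_dist_def)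
      also have "\<dots> = ?q powi (- int (c * J i))"
        unfolding power_int_minus power_int_of_nat by (simp add: a_def power_mult power_one_over inverse_eq_divide)
      finally show "fls_nth (block_series c f) k = fls_nth (block_series c g) k"
        unfolding laurent_abs_le_iff using k by auto
    qed
    then show ?thesis by (intro exI[of _ "map g [0..<J i]"]) auto
  qed
  then obtain l where l: "\<And>i. length (l i) = J i"
    "\<And>i f. (\<And>n. length (f n) = c) \<Longrightarrow> block_series c f \<in> U i \<Longrightarrow> map f [0..<J i] = l i"
    by metis
  have "(\<Sum>i. ennreal ((1 / real M) ^ length (l i))) \<le> (\<Sum>i. ennreal K * ennreal (r i powr s) + ennreal (?\<eta> i))"
  proof (intro suminf_le summableI)
    fix i
    have "ennreal ((1 / real M) ^ length (l i)) \<le> ennreal (K * r i powr s + ?\<eta> i)"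
      using J(2)[of i] unfolding l(1) by (rule ennreal_leI)
    also have "\<dots> = ennreal K * ennreal (r i powr s) + ennreal (?\<eta> i)"
      using K by (simp add: ennreal_mult)
    finally show "ennreal ((1 / real M) ^ length (l i)) \<le> ennreal K * ennreal (r i powr s) + ennreal (?\<eta> i)" .
  qed
  also have "\<dots> = ennreal K * (\<Sum>i. ennreal (r i powr s)) + (\<Sum>i. ennreal (?\<eta> i))"
    by (simp only: suminf_add[symmetric, OF summableI summableI] ennreal_suminf_cmult)
  also have "(\<Sum>i. ennreal (?\<eta> i)) = ennreal (1 / 2 * 1)"
    by (intro suminf_ennreal_eq sums_mult power_half_series) simp
  also have "ennreal K * (\<Sum>i. ennreal (r i powr s)) + ennreal (1 / 2 * 1)
      < ennreal K * ennreal (1 / (2 * K)) + ennreal (1 / 2 * 1)"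
  proof -
    have "(\<Sum>i. ennreal (r i powr s)) < ennreal (1 / (2 * K))"
      unfolding r_def by (rule U(3))
    then have "ennreal K * (\<Sum>i. ennreal (r i powr s)) < ennreal K * ennreal (1 / (2 * K))"
      using K by (intro ennreal_mult_strict_left_mono) auto
    then show ?thesis
      by (simp add: ennreal_add_left_cancel_less add.commute)
  qed
  also have "\<dots> = 1"
  proof -
    have "ennreal K * ennreal (1 / (2 * K)) = ennreal (1 / 2)"
      using K by (subst ennreal_mult[symmetric]) auto
    then show ?thesis by (simp only: mult_1_right flip: ennreal_plus) simp
  qed
  finally have less1: "(\<Sum>i. ennreal ((1 / real M) ^ length (l i))) < 1" .
  obtain f where f: "\<And>n. f n \<in> good_blocks Q c (map f [0..<n])" "\<And>i. map f [0..<length (l i)] \<noteq> l i"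
    using branch_avoiding_cylinders[of M "good_blocks Q c" l, OF M(1) finite_good_blocks _ less1]
      card_good_blocks[OF Q(1,2) c(1)] unfolding M_def by blast
  have "block_series c f \<in> BA \<theta>"
    using Q f(1) by (rule block_series_in_BA)
  then obtain i where "block_series c f \<in> U i" using U(1) by blast
  moreover have "length (f n) = c" for n using f(1)[of n] by (simp add: good_blocks_def)
  ultimately show False using l f(2)[of i] by metis
qed

theorem theorem3p5:
  fixes \<theta> :: "'a::{field,finite} fls"
  shows "hausdorff_dim laurent_dist (BA \<theta>) = 1"
proof (rule hausdorff_dim_eq_1I)
  show "hausdorff_measure laurent_dist s (BA \<theta>) = 0" if "s > 1" for s
    using that by (rule hausdorff_measure_laurent_eq_0)
  show "hausdorff_measure laurent_dist s (BA \<theta>) \<noteq> 0" if s: "0 < s" "s < 1" for s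
  proof
    assume "hausdorff_measure laurent_dist s (BA \<theta>) = 0"
    \<comment> \<open>The measure is a supremum over all scales, so positivity at scale 1 is
      enough.\<close>
    moreover have "hausdorff_premeasure laurent_dist s 1 (BA \<theta>) \<le> hausdorff_measure laurent_dist s (BA \<theta>)"
      unfolding hausdorff_measure_def by (intro SUP_upper) simp
    ultimately show False using hausdorff_premeasure_BA_neq_0[OF s, of \<theta>] by simp
  qed
qed

end
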